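(* Let $e$ be a positive integer with $e\le 3$. Let $h=(1,h_1,\dots,h_e)$ and $h'=(1,h'_1,\dots,h'_{e-1})$ be two pure $O$-sequences, and suppose that $(\Delta h')_i\le(\Delta h)_i$ for all $i\le\lceil e/2\rceil$, and $h'_i\le h_i$ for all $i\le e-1$. Then the shifted sum of $h$ and $h'$, \[h''=(1,\;h_1+1,\;h_2+h'_1,\;\dots,\;h_e+h'_{e-1}),\] is also a pure $O$-sequence.
   Context: A (monomial) order ideal is a finite nonempty set $X$ of monic monomials in indeterminates $y_1,\dots,y_r$ such that if $M\in X$ and $N$ divides $M$ then $N\in X$. It is pure if all its monomials that are maximal under divisibility have the same degree. The $h$-vector of $X$ is $(h_0=1,h_1,\dots,h_e)$, where $h_i$ is the number of monomials of degree $i$ in $X$ and $e$ is the largest degree of a monomial in $X$. A pure $O$-sequence is the $h$-vector of a pure order ideal; its last index $e$ is called its socle degree. For a vector $H=(1,H_1,H_2,\dots,H_t)$ of natural numbers, its first difference is $\Delta H=(1,H_1-1,H_2-H_1,\dots,H_t-H_{t-1})$, and $(\Delta H)_i$ denotes its entry of index $i$ (indices starting from $0$). When $e=1$, $h'=(1)$ and the inequality $(\Delta h')_1\le(\Delta h)_1$ is regarded as imposing no condition. *)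

theory Defs
  imports Complex_Main "HOL-Library.Multiset"
begin

text \<open>
  A monic monomial in the indeterminates \<open>y\<^sub>1, \<dots>, y\<^sub>r\<close> is the finite multiset of the
  indices of its factors. Divisibility is multiset inclusion \<open>\<subseteq>#\<close>, the degree is
  \<^const>\<open>size\<close>, and the monomial \<open>1\<close> is the empty multiset.
\<close>

type_synonym monomial = "nat multiset"

definition monomials :: "nat \<Rightarrow> monomial set" where
  "monomials r = {M. set_mset M \<subseteq> {1..r}}"

definition order_ideal :: "nat \<Rightarrow> monomial set \<Rightarrow> bool" where
  "order_ideal r X \<longleftrightarrow>
     finite X \<and> X \<noteq> {} \<and> X \<subseteq> monomials r \<and>
     (\<forall>M\<in>X. \<forall>N. N \<subseteq># M \<longrightarrow> N \<in> X)"

definition maximal_monomials :: "monomial set \<Rightarrow> monomial set" where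
  "maximal_monomials X = {M \<in> X. \<forall>N\<in>X. M \<subseteq># N \<longrightarrow> N = M}"

definition pure_order_ideal :: "nat \<Rightarrow> monomial set \<Rightarrow> bool" where
  "pure_order_ideal r X \<longleftrightarrow>
     order_ideal r X \<and>
     (\<forall>M\<in>maximal_monomials X. \<forall>N\<in>maximal_monomials X. size M = size N)"

text \<open>A vector \<open>(H\<^sub>0, \<dots>, H\<^sub>t)\<close> is a list of length \<open>t + 1\<close>, so that \<open>H\<^sub>i\<close> is \<open>H ! i\<close>.\<close>

definition h_vector :: "monomial set \<Rightarrow> nat list" where
  "h_vector X = map (\<lambda>i. card {M \<in> X. size M = i}) [0..<Suc (Max (size ` X))]"

text \<open>The socle degree of a pure \<open>O\<close>-sequence \<open>h\<close> is its last index, \<open>length h - 1\<close>.\<close>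

definition pure_O_sequence :: "nat list \<Rightarrow> bool" where
  "pure_O_sequence h \<longleftrightarrow> (\<exists>r X. pure_order_ideal r X \<and> h = h_vector X)"

text \<open>The entries are integers because they may be negative.\<close>

definition first_difference :: "nat list \<Rightarrow> int list" where
  "first_difference H = 1 # map (\<lambda>i. int (H ! i) - int (H ! (i - 1))) [1..<length H]"

text \<open>
  The entry of index 1 is \<open>h\<^sub>1 + h'\<^sub>0\<close>, which is \<open>h\<^sub>1 + 1\<close> since every
  pure \<open>O\<close>-sequence starts with 1.
\<close>

definition shifted_sum :: "nat list \<Rightarrow> nat list \<Rightarrow> nat list" where
  "shifted_sum h h' = 1 # map (\<lambda>i. h ! i + h' ! (i - 1)) [1..<length h]"

end

theory Submission
  imports Defs "HOL-Library.Nat_Bijection"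
begin

text \<open>
  A pure order ideal of socle degree \<open>e\<close> is generated by a set \<open>C\<close> of monomials of degree \<open>e\<close>,
  and its \<open>h\<close>-vector counts the monomials dividing elements of \<open>C\<close>.

  For \<open>e = 3\<close> view the monomials of degree 2 as the edges of a graph with loops on the variables.
  The pure \<open>O\<close>-sequences \<open>(1, a, b, c)\<close> with \<open>a\<close>, \<open>b\<close> fixed have \<open>c\<close> in an interval: its upper
  end is the Macaulay-type bound \<open>b + growth (b - a)\<close>, everything from \<open>b\<close> up to that bound is
  realised by graphs with a looped vertex adjacent to all vertices, and from any realisable \<open>c \<le> b\<close>
  one climbs to \<open>b\<close> by discarding generators and adding the lost edges back one at a time, each with
  a generator of its own. It remains to find some pure \<open>O\<close>-sequence
  \<open>(1, a + 1, b + p, c'')\<close> with \<open>c'' \<le> c + q\<close>. One with \<open>c'' \<le> c + \<lceil>p / 2\<rceil>\<close> arises from a new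
  variable \<open>y\<close> and generators \<open>y u w\<close> for disjoint pairs \<open>{u, w}\<close>: each of them accounts for at
  least two new edges.
\<close>

section \<open>Macaulay growth\<close>

lemma triangle_add: "triangle (m + n) = triangle m + triangle n + m * n"
  by (induction n) simp_all

text \<open>
  If \<open>g = (k choose 2) + j\<close> with \<open>0 \<le> j \<le> k\<close> then \<open>growth g = (k + 1 choose 3) + (j + 1 choose 2)\<close>,
  which is Macaulay's bound for the entry following \<open>g\<close> in degree 2. The \<open>i\<close>-th summand is the
  increment caused by the \<open>i\<close>-th pair \<open>m \<le> m + n\<close> in colexicographic order,
  \<open>(m, n) = prod_decode i\<close>.
\<close>

definition growth :: "nat \<Rightarrow> nat" where
  "growth g = (\<Sum>i<g. Suc (fst (prod_decode i)))"

lemma growth_add_ge: "growth g + n \<le> growth (g + n)"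
  by (induction n) (auto simp: growth_def)

text \<open>The indices \<open>triangle k\<close>, ..., \<open>triangle k + k\<close> decode to the
  diagonal \<open>(0, k)\<close>, \<open>(1, k - 1)\<close>, ..., \<open>(k, 0)\<close>, so the
  increments there are 1, 2, ..., \<open>k + 1\<close>. For \<open>m = Suc k\<close> the whole
  diagonal is covered.\<close>

lemma growth_triangle:
  assumes "m \<le> Suc k"
  shows "growth (triangle k + m) = growth (triangle k) + triangle m"
  using assms
proof (induction m)
  case 0
  then show ?case by simp
next
  case (Suc m)
  have "prod_encode (m, k - m) = triangle k + m"
    using Suc.prems by (simp add: prod_encode_def)
  then have "prod_decode (triangle k + m) = (m, k - m)"
    by (metis prod_encode_inverse)
  with Suc show ?case by (simp add: growth_def)
qed

text \<open>The difference is a window of \<open>n\<close> consecutive increments. If it stays in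
  the diagonal of \<open>g\<close>, or enters the next one by at most the number \<open>j\<close> of
  entries preceding \<open>g\<close> in its own, its sum is at least \<open>triangle n\<close>; a
  longer window sums to at least \<open>g + n\<close>.\<close>

lemma growth_window: "growth g + min (g + n) (triangle n) \<le> growth (g + n)"
proof -
  obtain j i where "prod_decode g = (j, i)" by (cases "prod_decode g")
  then have "g = prod_encode (j, i)" by (metis prod_decode_inverse)
  then have g: "g = triangle (j + i) + j" by (simp add: prod_encode_def)
  have g0: "growth g = growth (triangle (j + i)) + triangle j"
    unfolding g by (rule growth_triangle) simp
  show ?thesis
  proof (cases "n \<le> Suc i")
    case True
    then have "growth (g + n) = growth (triangle (j + i)) + triangle (j + n)"
      using growth_triangle[of "j + n" "j + i"] g by (simp add: ac_simps)
    then show ?thesis using g0 by (simp add: triangle_add)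
  next
    case False
    define m where "m = n - Suc i"
    have n: "n = Suc i + m" using False by (simp add: m_def)
    have gn: "g + n = triangle (Suc (j + i)) + m" using g n by simp
    have g1: "growth (triangle (Suc (j + i))) = growth (triangle (j + i)) + triangle (Suc (j + i))"
      using growth_triangle[of "Suc (j + i)" "j + i"] by simp
    show ?thesis
    proof (cases "m \<le> j")
      case True
      then obtain d where d: "j = m + d" using le_Suc_ex by blast
      have "growth (g + n) = growth (triangle (j + i)) + triangle (Suc (j + i)) + triangle m"
        unfolding gn using growth_triangle[of m "Suc (j + i)"] True g1 by simp
      \<comment> \<open>Convexity: with \<open>j = m + d\<close>, the arguments \<open>n\<close> and
        \<open>m + d\<close> have the same sum as \<open>n + d\<close> and \<open>m\<close>, and
        \<open>m <= n\<close>.\<close>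
      moreover have "triangle n + triangle j \<le> triangle (Suc (j + i)) + triangle m"
      proof -
        have "triangle (Suc (j + i)) = triangle (n + d)" using d n by (simp add: ac_simps del: triangle_Suc)
        moreover have "m * d \<le> n * d" using n by (intro mult_le_mono1) simp
        moreover have "triangle j = triangle m + triangle d + m * d" by (simp add: d triangle_add)
        ultimately show ?thesis using triangle_add[of n d] by linarith
      qed
      ultimately show ?thesis using g0 by simp
    next
      case False
      \<comment> \<open>The increments 1, ..., \<open>j + 1\<close> of the next diagonal make up for
        the \<open>j\<close> increments missed before \<open>g\<close>, with \<open>j + 1\<close> to
        spare; each of the remaining \<open>l\<close> is at least 1.\<close>
      define l where "l = m - Suc j"
      have l: "m = Suc j + l" using False by (simp add: l_def)
      have "g + n = triangle (Suc (j + i)) + Suc j + l" unfolding gn l by simp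
      then have "growth (triangle (Suc (j + i)) + Suc j) + l \<le> growth (g + n)"
        using growth_add_ge[of "triangle (Suc (j + i)) + Suc j" l] by metis
      moreover have "growth (triangle (Suc (j + i)) + Suc j)
          = growth (triangle (Suc (j + i))) + triangle (Suc j)"
        by (rule growth_triangle) simp
      ultimately have "growth g + (g + n) \<le> growth (g + n)"
        using g0 g1 unfolding gn l triangle_Suc by linarith
      then show ?thesis by simp
    qed
  qed
qed

section \<open>Generators and their divisors\<close>

definition uniform :: "nat \<Rightarrow> monomial set \<Rightarrow> bool" where
  "uniform k C \<longleftrightarrow> finite C \<and> (\<forall>M\<in>C. size M = k)"

definition verts :: "monomial set \<Rightarrow> nat set" where
  "verts C = (\<Union>M\<in>C. set_mset M)"

definition shadow :: "nat \<Rightarrow> monomial set \<Rightarrow> monomial set" where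
  "shadow i C = {N. size N = i \<and> (\<exists>M\<in>C. N \<subseteq># M)}"

definition pairs :: "nat set \<Rightarrow> monomial set" where
  "pairs S = {N. size N = 2 \<and> set_mset N \<subseteq> S}"

lemma size2E:
  assumes "size N = 2"
  obtains x y where "N = {#x, y#}"
proof -
  have "size N = Suc 1" using assms by simp
  then obtain x K where K: "N = add_mset x K"
    by (metis size_eq_Suc_imp_eq_union)
  then have "size K = 1" using assms by simp
  then obtain y where "K = {#y#}" using size_1_singleton_mset by blast
  with K that show thesis by blast
qed

lemma size3E:
  assumes "size N = 3"
  obtains x y z where "N = {#x, y, z#}"
proof -
  have "size N = Suc 2" using assms by simp
  then obtain x K where K: "N = add_mset x K"
    by (metis size_eq_Suc_imp_eq_union)
  then have "size K = 2" using assms by simp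
  then obtain y z where "K = {#y, z#}" by (rule size2E)
  with K that show thesis by blast
qed

lemma pair_eq_iff: "{#x, y#} = {#u, v#} \<longleftrightarrow> x = u \<and> y = v \<or> x = v \<and> y = u"
  by (auto simp: add_eq_conv_ex)

lemma pairs_insert: "pairs (insert v S) = pairs S \<union> (\<lambda>w. {#v, w#}) ` insert v S"
proof
  show "pairs (insert v S) \<subseteq> pairs S \<union> (\<lambda>w. {#v, w#}) ` insert v S"
  proof
    fix N assume N: "N \<in> pairs (insert v S)"
    then obtain x y where xy: "N = {#x, y#}" by (auto simp: pairs_def elim: size2E)
    with N have "x \<in> insert v S" "y \<in> insert v S" by (auto simp: pairs_def)
    with xy show "N \<in> pairs S \<union> (\<lambda>w. {#v, w#}) ` insert v S"
      by (cases "x = v"; cases "y = v") (auto simp: pairs_def add_mset_commute)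
  qed
qed (auto simp: pairs_def)

text \<open>A new vertex brings one edge to each old vertex and its own loop, which is the next
  summand of \<open>triangle\<close>.\<close>

lemma card_pairs:
  assumes "finite S"
  shows "finite (pairs S) \<and> card (pairs S) = triangle (card S)"
  using assms
proof (induction S)
  case empty
  have "pairs {} = {}" by (auto simp: pairs_def)
  then show ?case by simp
next
  case (insert v S)
  have "inj_on (\<lambda>w. {#v, w#}) (insert v S)" by (auto simp: inj_on_def)
  then have "card ((\<lambda>w. {#v, w#}) ` insert v S) = Suc (card S)"
    using insert by (simp add: card_image del: image_insert)
  moreover have "pairs S \<inter> (\<lambda>w. {#v, w#}) ` insert v S = {}"
    using insert by (auto simp: pairs_def)
  ultimately show ?case
    using insert by (simp add: pairs_insert card_Un_disjoint del: image_insert)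
qed

lemma finite_divisors: "finite {N. N \<subseteq># (M :: monomial)}"
proof (induction M)
  case (add x M)
  have "{N. N \<subseteq># add_mset x M} \<subseteq> {N. N \<subseteq># M} \<union> add_mset x ` {N. N \<subseteq># M}"
  proof
    fix N assume N: "N \<in> {N. N \<subseteq># add_mset x M}"
    show "N \<in> {N. N \<subseteq># M} \<union> add_mset x ` {N. N \<subseteq># M}"
    proof (cases "x \<in># N")
      case True
      then obtain K where "N = add_mset x K" by (metis mset_add)
      with N show ?thesis by auto
    next
      case False
      have "count N a \<le> count M a" for a
        using N mset_subset_eq_count[of N "add_mset x M" a] False
        by (cases "a = x") (auto simp: count_eq_zero_iff[THEN iffD2])
      then have "N \<subseteq># M" by (rule mset_subset_eqI)
      then show ?thesis by simp
    qed
  qed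
  then show ?case using add by (meson finite_UnI finite_imageI finite_subset)
qed simp

lemma finite_shadow: "finite C \<Longrightarrow> finite (shadow i C)"
  by (rule finite_subset[of _ "\<Union>M\<in>C. {N. N \<subseteq># M}"]) (auto simp: shadow_def finite_divisors)

lemma finite_verts: "finite C \<Longrightarrow> finite (verts C)"
  by (simp add: verts_def)

lemma shadow_mono: "C \<subseteq> D \<Longrightarrow> shadow i C \<subseteq> shadow i D"
  by (auto simp: shadow_def)

lemma verts_mono: "C \<subseteq> D \<Longrightarrow> verts C \<subseteq> verts D"
  by (auto simp: verts_def)

lemma verts_insert: "verts (insert M C) = set_mset M \<union> verts C"
  by (auto simp: verts_def)

lemma card_shadow_1: "card (shadow 1 C) = card (verts C)"
proof -
  have "shadow 1 C = (\<lambda>v. {#v#}) ` verts C"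
  proof (rule set_eqI)
    fix N
    show "N \<in> shadow 1 C \<longleftrightarrow> N \<in> (\<lambda>v. {#v#}) ` verts C"
    proof (cases "size N = 1")
      case True
      then obtain v where "N = {#v#}" using size_1_singleton_mset by blast
      then show ?thesis by (auto simp: shadow_def verts_def)
    qed (auto simp: shadow_def)
  qed
  moreover have "inj_on (\<lambda>v. {#v#}) (verts C)" by (simp add: inj_on_def)
  ultimately show ?thesis by (metis card_image)
qed

lemma subseteq_size_eq: "N \<subseteq># M \<Longrightarrow> size N = size M \<Longrightarrow> N = M"
  by (metis mset_subset_size nat_neq_iff subset_mset.le_neq_trans)

lemma shadow_uniform: "uniform k C \<Longrightarrow> shadow k C = C"
  unfolding shadow_def uniform_def by (auto dest: subseteq_size_eq)

lemma shadow_subset_pairs: "shadow 2 C \<subseteq> pairs (verts C)"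
  by (auto simp: shadow_def pairs_def verts_def dest: set_mset_mono)

text \<open>A divisor of degree 2 omits exactly one factor \<open>w\<close>. The factors may
  coincide, so the set can have fewer than three elements.\<close>

lemma divisors_triple:
  "{N. size N = 2 \<and> N \<subseteq># {#x, y, z#}} = {{#x, y#}, {#x, z#}, {#y, z#}}"
proof
  show "{N. size N = 2 \<and> N \<subseteq># {#x, y, z#}} \<subseteq> {{#x, y#}, {#x, z#}, {#y, z#}}"
  proof
    fix N assume "N \<in> {N. size N = 2 \<and> N \<subseteq># {#x, y, z#}}"
    then have N: "size N = 2" "N \<subseteq># {#x, y, z#}" by auto
    then obtain K where K: "{#x, y, z#} = N + K" by (auto simp: subset_mset.le_iff_add)
    have "size {#x, y, z#} = size N + size K" by (simp only: K size_union)
    then have "size K = 1" using N(1) by simp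
    then obtain w where "K = {#w#}" using size_1_singleton_mset by blast
    then have eq: "{#x, y, z#} = add_mset w N" using K by simp
    then have "w \<in># {#x, y, z#}" by (simp only:) simp
    then consider "w = x" | "w = y" | "w = z" by auto
    then show "N \<in> {{#x, y#}, {#x, z#}, {#y, z#}}"
    proof cases
      case 1
      with eq show ?thesis by simp
    next
      case 2
      have "add_mset y {#x, z#} = add_mset w N" using eq by (simp only: add_mset_commute)
      with 2 show ?thesis by simp
    next
      case 3
      have "add_mset z {#x, y#} = add_mset w N" using eq by (simp only: add_mset_commute)
      with 3 show ?thesis by simp
    qed
  qed
next
  have "{#y, z#} \<subseteq># add_mset x {#y, z#}" by (rule subset_mset.less_imp_le) simp
  then show "{{#x, y#}, {#x, z#}, {#y, z#}} \<subseteq> {N. size N = 2 \<and> N \<subseteq># {#x, y, z#}}"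
    by simp
qed

lemma shadow_insert_triple:
  "shadow 2 (insert {#x, y, z#} C) = {{#x, y#}, {#x, z#}, {#y, z#}} \<union> shadow 2 C"
proof -
  have "shadow 2 (insert M C) = {N. size N = 2 \<and> N \<subseteq># M} \<union> shadow 2 C" for M
    by (auto simp: shadow_def)
  then show ?thesis by (simp only: divisors_triple)
qed

section \<open>The upper bound in degree 3\<close>

text \<open>An edge inside \<open>S\<close> counts even if its generators leave \<open>S\<close>.
  Thus, for a generator \<open>v x y\<close> with \<open>x\<close>, \<open>y\<close> in
  \<open>S\<close>, the edge \<open>x y\<close> is present before \<open>v\<close> is added.\<close>

definition edges_in :: "monomial set \<Rightarrow> nat set \<Rightarrow> monomial set" where
  "edges_in C S = shadow 2 C \<inter> pairs S"

definition triples_in :: "monomial set \<Rightarrow> nat set \<Rightarrow> monomial set" where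
  "triples_in C S = {M \<in> C. set_mset M \<subseteq> S}"

text \<open>
  The first conjunct says that the excess of edges over vertices is largest for \<open>S\<close> itself. It
  bounds the edges inside the neighbourhood of a vertex \<open>v\<close> added to \<open>S\<close>, and these correspond to
  the new generators containing \<open>v\<close> only once.
\<close>

definition macaulay_bounded :: "monomial set \<Rightarrow> nat set \<Rightarrow> bool" where
  "macaulay_bounded C S \<longleftrightarrow>
     (\<forall>N\<subseteq>S. card (edges_in C N) + card S \<le> card (edges_in C S) + card N) \<and>
     card (triples_in C S) \<le> card (edges_in C S) + growth (card (edges_in C S) - card S)"

lemma edge_in_triple:
  assumes "{#x, y, z#} \<in> C"
  shows "{#x, y#} \<in> shadow 2 C" "{#x, z#} \<in> shadow 2 C" "{#y, z#} \<in> shadow 2 C"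
  using shadow_insert_triple[of x y z C] assms by (auto simp: insert_absorb)

lemma finite_edges_in: "finite C \<Longrightarrow> finite (edges_in C S)"
  by (simp add: edges_in_def finite_shadow)

lemma edges_in_insert:
  "edges_in C (insert v S) = edges_in C S \<union> (\<lambda>w. {#v, w#}) ` {w \<in> insert v S. {#v, w#} \<in> shadow 2 C}"
  unfolding edges_in_def pairs_insert by auto

lemma card_edges_in_insert:
  assumes "finite C" "finite S" "v \<notin> S"
  shows "card (edges_in C (insert v S))
    = card (edges_in C S) + card {w \<in> insert v S. {#v, w#} \<in> shadow 2 C}"
proof -
  let ?B = "{w \<in> insert v S. {#v, w#} \<in> shadow 2 C}"
  have "inj_on (\<lambda>w. {#v, w#}) ?B" by (auto simp: inj_on_def)
  then have "card ((\<lambda>w. {#v, w#}) ` ?B) = card ?B" by (rule card_image)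
  moreover have "edges_in C S \<inter> (\<lambda>w. {#v, w#}) ` ?B = {}"
    using assms by (auto simp: edges_in_def pairs_def)
  ultimately show ?thesis
    using assms unfolding edges_in_insert by (simp add: card_Un_disjoint finite_edges_in)
qed

lemma triple_through_vertex:
  assumes "uniform 3 C" "M \<in> C" "v \<in># M"
  obtains x y where "M = {#v, x, y#}" "{#v, x#} \<in> shadow 2 C" "{#v, y#} \<in> shadow 2 C"
    "{#x, y#} \<in> shadow 2 C"
proof -
  obtain K where K: "M = add_mset v K" using assms(3) by (metis mset_add)
  then have "size K = 2" using assms by (auto simp: uniform_def)
  then obtain x y where "K = {#x, y#}" by (rule size2E)
  with K assms(2) edge_in_triple[of v x y C] that show thesis by blast
qed

text \<open>Dividing a new generator by \<open>v\<close> gives an edge inside the neighbourhood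
  \<open>A\<close> or, if \<open>v\<close> has a loop, possibly an edge at \<open>v\<close>. The
  edges inside \<open>A\<close> are bounded by the excess plus \<open>card A\<close> and by
  \<open>triangle (card A)\<close>; \<open>growth_window\<close> shows that the bound rises by
  enough.\<close>

lemma macaulay_bounded_insert:
  assumes C: "uniform 3 C" and S: "finite S" "v \<notin> S" and good: "macaulay_bounded C S"
    and B: "{w \<in> insert v S. {#v, w#} \<in> shadow 2 C} \<noteq> {}" (is "?B \<noteq> {}")
  shows "macaulay_bounded C (insert v S)"
  unfolding macaulay_bounded_def
proof (intro conjI allI impI)
  have fin: "finite C" using C by (simp add: uniform_def)
  have finB: "finite ?B" using S by simp
  have d: "card ?B > 0" using B finB by (simp add: card_gt_0_iff)
  have eS: "card (edges_in C (insert v S)) = card (edges_in C S) + card ?B"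
    by (rule card_edges_in_insert) (use fin S in auto)
  have excess: "card (edges_in C N) + card S \<le> card (edges_in C S) + card N" if "N \<subseteq> S" for N
    using good that by (simp add: macaulay_bounded_def)
  show "card (edges_in C N) + card (insert v S) \<le> card (edges_in C (insert v S)) + card N"
    if N: "N \<subseteq> insert v S" for N
  proof (cases "v \<in> N")
    case False
    then have "N \<subseteq> S" using N by auto
    then show ?thesis using excess[of N] S eS d by simp
  next
    case True
    then obtain N' where N': "N = insert v N'" "v \<notin> N'" by (meson mk_disjoint_insert)
    then have sub: "N' \<subseteq> S" and fN: "finite N'" using N S by (auto intro: finite_subset)
    have "card {w \<in> insert v N'. {#v, w#} \<in> shadow 2 C} \<le> card ?B"
      by (rule card_mono) (use sub finB in auto)
    then show ?thesis
      using excess[OF sub] S eS N' fN card_edges_in_insert[OF fin fN N'(2)] by simp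
  qed
  define A where "A = {w \<in> S. {#v, w#} \<in> shadow 2 C}"
  define loop where "loop \<longleftrightarrow> {#v, v#} \<in> shadow 2 C"
  have AS: "A \<subseteq> S" and finA: "finite A" using S by (auto simp: A_def)
  have BA: "?B = (if loop then insert v A else A)" by (auto simp: A_def loop_def)
  have vA: "v \<notin> A" using S by (simp add: A_def)
  \<comment> \<open>These are the quotients by \<open>v\<close> of generators divisible by
    \<open>v v\<close>; such generators force the loop at \<open>v\<close>.\<close>
  define L where "L = (if loop then (\<lambda>w. {#v, w#}) ` ?B else {})"
  have cardL: "card L \<le> (if loop then card ?B else 0)"
    unfolding L_def using card_image_le[OF finB, of "\<lambda>w. {#v, w#}"] by (simp del: insert_iff)
  have "triples_in C (insert v S) \<subseteq> triples_in C S \<union> add_mset v ` (L \<union> edges_in C A)"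
  proof
    fix M assume M: "M \<in> triples_in C (insert v S)"
    show "M \<in> triples_in C S \<union> add_mset v ` (L \<union> edges_in C A)"
    proof (cases "v \<in># M")
      case False
      then show ?thesis using M by (auto simp: triples_in_def)
    next
      case True
      from M have "M \<in> C" by (simp add: triples_in_def)
      then obtain x y where xy: "M = {#v, x, y#}" "{#v, x#} \<in> shadow 2 C"
        "{#v, y#} \<in> shadow 2 C" "{#x, y#} \<in> shadow 2 C"
        using triple_through_vertex[OF C _ True] by metis
      have ins: "x \<in> insert v S" "y \<in> insert v S" using M xy(1) by (auto simp: triples_in_def)
      have "{#x, y#} \<in> L \<union> edges_in C A"
      proof (cases "x = v \<or> y = v")
        case True
        then have loop using xy by (auto simp: loop_def)
        moreover have "{#x, y#} = {#v, y#} \<or> {#x, y#} = {#v, x#}"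
          using True by (auto simp: add_mset_commute)
        ultimately show ?thesis using xy ins by (auto simp: L_def)
      next
        case False
        then show ?thesis using xy ins by (auto simp: edges_in_def pairs_def A_def)
      qed
      then show ?thesis using xy(1) by blast
    qed
  qed
  moreover have finU: "finite (triples_in C S)" "finite (L \<union> edges_in C A)"
    using fin finB by (auto simp: triples_in_def L_def finite_edges_in)
  ultimately have "card (triples_in C (insert v S))
      \<le> card (triples_in C S \<union> add_mset v ` (L \<union> edges_in C A))"
    by (intro card_mono) auto
  also have "\<dots> \<le> card (triples_in C S) + card (add_mset v ` (L \<union> edges_in C A))"
    by (rule card_Un_le)
  also have "card (add_mset v ` (L \<union> edges_in C A)) \<le> card (L \<union> edges_in C A)"
    using finU(2) by (rule card_image_le)
  also have "card (L \<union> edges_in C A) \<le> card L + card (edges_in C A)" by (rule card_Un_le)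
  finally have t: "card (triples_in C (insert v S)) \<le> card (triples_in C S) + card L + card (edges_in C A)"
    by simp
  define g where "g = card (edges_in C S) - card S"
  \<comment> \<open>The first conjunct for the empty set gives
    \<open>card S <= card (edges_in C S)\<close>, so the natural subtraction in \<open>g\<close> is
    exact.\<close>
  have g: "card (edges_in C S) = g + card S"
    using excess[of "{}"] by (simp add: g_def edges_in_def)
  have eA: "card (edges_in C A) \<le> g + card A" using excess[OF AS] g by simp
  have eA': "card (edges_in C A) \<le> triangle (card A)"
    using card_pairs[OF finA] card_mono[of "pairs A" "edges_in C A"] by (auto simp: edges_in_def)
  have tS: "card (triples_in C S) \<le> card (edges_in C S) + growth g"
    using good by (simp add: macaulay_bounded_def g_def)
  define n where "n = card ?B - 1"
  have n: "card ?B = Suc n" using d by (simp add: n_def)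
  have win: "growth g + min (g + n) (triangle n) \<le> growth (g + n)" by (rule growth_window)
  have ex: "card (edges_in C (insert v S)) - card (insert v S) = g + n"
    using eS g n S by simp
  show "card (triples_in C (insert v S)) \<le> card (edges_in C (insert v S))
      + growth (card (edges_in C (insert v S)) - card (insert v S))"
  proof (cases loop)
    case True
    then have "card A = n" using n BA finA vA by simp
    moreover have "card L \<le> Suc n" using True cardL n by simp
    ultimately show ?thesis using t tS eA eA' eS win n unfolding ex by simp
  next
    case False
    then have "card A = Suc n" using n BA by simp
    moreover have "card L = 0" using False by (simp add: L_def)
    ultimately show ?thesis using t tS eA eA' eS win n unfolding ex by simp
  qed
qed

text \<open>
  If no single vertex can be added with an edge, all generators outside \<open>S\<close> are disjoint
  triangles without loops.
\<close>

lemma macaulay_bounded_insert_triangle: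
  assumes C: "uniform 3 C" and S: "finite S" and v: "v \<in> verts C" "v \<notin> S"
    and good: "macaulay_bounded C S"
    and isolated: "\<And>u w. u \<notin> S \<Longrightarrow> w \<in> insert u S \<Longrightarrow> {#u, w#} \<notin> shadow 2 C"
  shows "\<exists>S'. S \<subset> S' \<and> S' \<subseteq> S \<union> verts C \<and> macaulay_bounded C S'"
proof -
  have fin: "finite C" using C by (simp add: uniform_def)
  have excess: "card (edges_in C N) + card S \<le> card (edges_in C S) + card N" if "N \<subseteq> S" for N
    using good that by (simp add: macaulay_bounded_def)
  from v obtain M where M: "M \<in> C" "v \<in># M" by (auto simp: verts_def)
  then obtain x y where xy: "M = {#v, x, y#}" "{#v, x#} \<in> shadow 2 C"
    "{#v, y#} \<in> shadow 2 C" "{#x, y#} \<in> shadow 2 C"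
    using triple_through_vertex[OF C] by metis
  have out: "w \<notin> S \<and> w \<noteq> u" if "{#u, w#} \<in> shadow 2 C" "u \<notin> S" for u w
    using isolated that by blast
  have xv: "x \<notin> S" "x \<noteq> v" and yv: "y \<notin> S" "y \<noteq> v" using out[of v] xy v by auto
  have yx: "y \<noteq> x" using out[of x y] xy xv by auto
  define T where "T = {v, x, y}"
  define E where "E = {{#v, x#}, {#v, y#}, {#x, y#}}"
  have cardE: "card E = 3" using xv yv yx by (auto simp: E_def pair_eq_iff card_insert_if)
  have cardT: "card T = 3" using xv yv yx by (simp add: T_def)
  have ST: "S \<inter> T = {}" using xv yv v by (auto simp: T_def)
  have sub: "edges_in C N \<subseteq> edges_in C (N \<inter> S) \<union> (E \<inter> pairs (N \<inter> T))" if N: "N \<subseteq> S \<union> T" for N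
  proof
    fix K assume K: "K \<in> edges_in C N"
    then obtain a b where ab: "K = {#a, b#}" by (auto simp: edges_in_def pairs_def elim: size2E)
    have abN: "a \<in> N" "b \<in> N" and E: "{#a, b#} \<in> shadow 2 C" "{#b, a#} \<in> shadow 2 C"
      using K ab by (auto simp: edges_in_def pairs_def add_mset_commute)
    show "K \<in> edges_in C (N \<inter> S) \<union> (E \<inter> pairs (N \<inter> T))"
    proof (cases "a \<in> S")
      case True
      then have "b \<in> S" using out[of b a] E by auto
      then show ?thesis using True K ab by (auto simp: edges_in_def pairs_def)
    next
      case False
      then have "b \<notin> S" "b \<noteq> a" using out[of a b] E by auto
      then have "a \<in> T" "b \<in> T" "a \<noteq> b" using False N abN by auto
      then show ?thesis using ab abN
        by (auto simp: T_def E_def pairs_def add_mset_commute)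
    qed
  qed
  have eN: "card (edges_in C N) \<le> card (edges_in C (N \<inter> S)) + card (N \<inter> T)" if N: "N \<subseteq> S \<union> T" for N
  proof -
    \<comment> \<open>A loopless triangle has 0, 0, 1, 3 edges inside 0, 1, 2, 3 of its
      vertices.\<close>
    have "card (E \<inter> pairs (N \<inter> T)) \<le> card (N \<inter> T)"
      by (cases "v \<in> N"; cases "x \<in> N"; cases "y \<in> N")
        (use xv yv yx in \<open>auto simp: E_def T_def pairs_def card_insert_if pair_eq_iff Int_insert_right Int_insert_left\<close>)
    moreover have "card (edges_in C N) \<le> card (edges_in C (N \<inter> S) \<union> (E \<inter> pairs (N \<inter> T)))"
      by (rule card_mono) (use sub[OF N] fin in \<open>auto simp: finite_edges_in E_def\<close>)
    moreover have "\<dots> \<le> card (edges_in C (N \<inter> S)) + card (E \<inter> pairs (N \<inter> T))" by (rule card_Un_le)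
    ultimately show ?thesis by linarith
  qed
  have eST: "card (edges_in C (S \<union> T)) = card (edges_in C S) + 3"
  proof -
    have "edges_in C (S \<union> T) = edges_in C S \<union> E"
    proof
      show "edges_in C (S \<union> T) \<subseteq> edges_in C S \<union> E"
        using sub[of "S \<union> T"] ST by (auto simp: Int_Un_distrib2 Int_commute)
      show "edges_in C S \<union> E \<subseteq> edges_in C (S \<union> T)"
        using xy by (auto simp: edges_in_def pairs_def E_def T_def)
    qed
    moreover have "edges_in C S \<inter> E = {}"
      using xv yv v by (auto simp: E_def edges_in_def pairs_def)
    moreover have "finite E" by (simp add: E_def)
    ultimately show ?thesis using cardE fin by (simp add: card_Un_disjoint finite_edges_in)
  qed
  have cST: "card (S \<union> T) = card S + 3"
  proof -
    have "finite T" by (simp add: T_def)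
    then show ?thesis using ST cardT S by (simp add: card_Un_disjoint)
  qed
  \<comment> \<open>A generator leaving \<open>S\<close> has three distinct factors outside
    \<open>S\<close>, hence exactly those in \<open>T\<close>. So \<open>T\<close> adds three
    vertices, three edges and at most one generator, and the excess is unchanged.\<close>
  have "triples_in C (S \<union> T) \<subseteq> insert M (triples_in C S)"
  proof
    fix K assume K: "K \<in> triples_in C (S \<union> T)"
    show "K \<in> insert M (triples_in C S)"
    proof (cases "set_mset K \<subseteq> S")
      case True
      then show ?thesis using K by (simp add: triples_in_def)
    next
      case False
      then obtain u where u: "u \<in># K" "u \<notin> S" by auto
      have "K \<in> C" using K by (simp add: triples_in_def)
      then obtain a b where ab: "K = {#u, a, b#}" "{#u, a#} \<in> shadow 2 C"
        "{#u, b#} \<in> shadow 2 C" "{#a, b#} \<in> shadow 2 C"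
        using triple_through_vertex[OF C _ u(1)] by metis
      have "a \<notin> S" "a \<noteq> u" "b \<notin> S" "b \<noteq> u" using out[of u] ab u by auto
      moreover from this have "b \<noteq> a" using out[of a b] ab by auto
      moreover have "{u, a, b} \<subseteq> S \<union> T" using K ab(1) by (auto simp: triples_in_def)
      ultimately have "K = M"
        using u(2) unfolding ab(1) xy(1) T_def by (auto simp: add_mset_commute)
      then show ?thesis by simp
    qed
  qed
  then have "card (triples_in C (S \<union> T)) \<le> card (insert M (triples_in C S))"
    by (rule card_mono[rotated]) (use fin in \<open>auto simp: triples_in_def\<close>)
  also have "\<dots> \<le> Suc (card (triples_in C S))"
    by (rule card_insert_le_m1) (auto)
  finally have "card (triples_in C (S \<union> T)) \<le> Suc (card (triples_in C S))" .
  moreover have "card (triples_in C S) \<le> card (edges_in C S) + growth (card (edges_in C S) - card S)"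
    using good by (simp add: macaulay_bounded_def)
  ultimately have "macaulay_bounded C (S \<union> T)"
    unfolding macaulay_bounded_def eST cST
  proof (intro conjI allI impI)
    fix N assume N: "N \<subseteq> S \<union> T"
    have "finite N" using finite_subset[OF N] S by (simp add: T_def)
    then have "card N = card (N \<inter> S) + card (N \<inter> T)"
      using N ST card_Un_disjoint[of "N \<inter> S" "N \<inter> T"] by (auto simp flip: Int_Un_distrib simp: Int_absorb2)
    then show "card (edges_in C N) + (card S + 3) \<le> card (edges_in C S) + 3 + card N"
      using eN[OF N] excess[of "N \<inter> S"] by simp
  qed simp
  moreover have "S \<subset> S \<union> T" using v by (auto simp: T_def)
  moreover have "set_mset M \<subseteq> verts C" using M(1) by (auto simp: verts_def)
  then have "T \<subseteq> verts C" by (simp add: xy(1) T_def)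
  ultimately show ?thesis by blast
qed

text \<open>Start from the empty set and take a maximal bounded set \<open>S\<close> of vertices. By
  maximality no outside vertex has a loop or an edge into \<open>S\<close>, so a remaining vertex
  would allow a triangle to be added.\<close>

lemma macaulay_bounded_verts:
  assumes C: "uniform 3 C"
  shows "macaulay_bounded C (verts C)"
proof -
  have fin: "finite C" using C by (simp add: uniform_def)
  let ?F = "{S. S \<subseteq> verts C \<and> macaulay_bounded C S}"
  have "triples_in C {} = {}" using C by (auto simp: triples_in_def uniform_def)
  then have "macaulay_bounded C {}" by (simp add: macaulay_bounded_def)
  then have "?F \<noteq> {}" by blast
  moreover have "finite ?F" using finite_verts[OF fin] by simp
  ultimately obtain S where S: "S \<subseteq> verts C" "macaulay_bounded C S"
    and max: "\<And>S'. S' \<subseteq> verts C \<Longrightarrow> macaulay_bounded C S' \<Longrightarrow> S \<subseteq> S' \<Longrightarrow> S = S'"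
    using finite_has_maximal[of ?F] by (metis (mono_tags, lifting) mem_Collect_eq)
  have finS: "finite S" using S finite_verts[OF fin] finite_subset by blast
  have isolated: "{#u, w#} \<notin> shadow 2 C" if uw: "u \<notin> S" "w \<in> insert u S" for u w
  proof
    assume e: "{#u, w#} \<in> shadow 2 C"
    then have "macaulay_bounded C (insert u S)"
      using uw by (intro macaulay_bounded_insert C finS S) auto
    moreover have "u \<in> verts C" using e shadow_subset_pairs[of C] by (auto simp: pairs_def)
    ultimately show False using max[of "insert u S"] S uw by auto
  qed
  have "v \<in> S" if "v \<in> verts C" for v
  proof (rule ccontr)
    assume "v \<notin> S"
    with macaulay_bounded_insert_triangle[OF C finS that _ S(2)] isolated
    obtain S' where "S \<subset> S'" "S' \<subseteq> S \<union> verts C" "macaulay_bounded C S'" by blast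
    with max[of S'] S show False by blast
  qed
  with S have "S = verts C" by blast
  with S show ?thesis by simp
qed

lemma edges_in_verts: "edges_in C (verts C) = shadow 2 C"
  using shadow_subset_pairs by (auto simp: edges_in_def)

text \<open>Discarding generators never raises the excess of edges over vertices. This supplies the
  hypothesis of \<open>completion\<close> that at least as many edges as vertices are
  missing.\<close>

lemma shadow_excess_mono:
  assumes "uniform 3 C" "D \<subseteq> C"
  shows "card (shadow 2 D) + card (verts C) \<le> card (shadow 2 C) + card (verts D)"
proof -
  have fin: "finite C" using assms by (simp add: uniform_def)
  have "shadow 2 D \<subseteq> edges_in C (verts D)"
    using shadow_mono[OF assms(2)] shadow_subset_pairs[of D] by (auto simp: edges_in_def)
  then have "card (shadow 2 D) \<le> card (edges_in C (verts D))"
    by (simp add: card_mono fin finite_edges_in)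
  moreover have "card (edges_in C (verts D)) + card (verts C) \<le> card (shadow 2 C) + card (verts D)"
    using macaulay_bounded_verts[OF assms(1)] verts_mono[OF assms(2)]
    by (simp add: macaulay_bounded_def edges_in_verts)
  ultimately show ?thesis by linarith
qed

lemma card_verts_le_shadow:
  assumes "uniform 3 C"
  shows "card (verts C) \<le> card (shadow 2 C)"
  using shadow_excess_mono[OF assms, of "{}"] by (simp add: shadow_def verts_def)

lemma card_shadow_le_triangle:
  assumes "finite C"
  shows "card (shadow 2 C) \<le> triangle (card (verts C))"
  using card_pairs[OF finite_verts[OF assms]] card_mono[OF _ shadow_subset_pairs[of C]] by simp

lemma card_triples_le:
  assumes "uniform 3 C"
  shows "card C \<le> card (shadow 2 C) + growth (card (shadow 2 C) - card (verts C))"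
proof -
  have "triples_in C (verts C) = C" by (auto simp: triples_in_def verts_def)
  then show ?thesis
    using macaulay_bounded_verts[OF assms] by (simp add: macaulay_bounded_def edges_in_verts)
qed

section \<open>Intervals of realisable sequences\<close>

lemma fresh_vertex:
  assumes "finite C"
  obtains y where "y \<notin> verts C"
  using ex_new_if_finite[OF infinite_UNIV_nat finite_verts[OF assms]] by blast

lemma pair_not_in_shadow: "y \<notin> verts C \<or> z \<notin> verts C \<Longrightarrow> {#y, z#} \<notin> shadow 2 C"
  using shadow_subset_pairs[of C] by (auto simp: pairs_def)

lemma uniform_insert_triple: "uniform 3 (insert {#x, y, z#} C) \<longleftrightarrow> uniform 3 C"
  by (auto simp: uniform_def)

lemma new_triple: "{#x, y#} \<notin> shadow 2 C \<Longrightarrow> {#x, y, z#} \<notin> C"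
  using edge_in_triple by blast

text \<open>Every step adds one generator with exactly one new edge. While vertices are missing it
  is \<open>y y y\<close> with \<open>y\<close> fresh; afterwards, for a missing edge
  \<open>x y\<close>, it is \<open>x x y\<close> if the loop at \<open>x\<close> is present and
  \<open>x x x\<close> otherwise.\<close>

lemma completion:
  assumes "uniform 3 C" "card (shadow 2 C) + a \<le> b + card (verts C)"
    "card (verts C) \<le> a" "card (shadow 2 C) \<le> b" "b \<le> triangle a"
  shows "\<exists>D. uniform 3 D \<and> card (verts D) = a \<and> card (shadow 2 D) = b \<and>
    card D = card C + (b - card (shadow 2 C))"
  using assms
proof (induction "b - card (shadow 2 C)" arbitrary: C)
  case 0
  then have "card (shadow 2 C) = b" "card (verts C) = a" by auto
  then show ?case using 0 by auto
next
  case (Suc n)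
  have fin: "finite C" using Suc.prems by (simp add: uniform_def)
  have step: ?case if new: "{#x, y#} \<notin> shadow 2 C"
    and sh: "shadow 2 (insert {#x, y, z#} C) = insert {#x, y#} (shadow 2 C)"
    and ex: "card (verts (insert {#x, y, z#} C)) \<le> a"
      "Suc (card (shadow 2 C)) + a \<le> b + card (verts (insert {#x, y, z#} C))"
    for x y z
  proof -
    let ?C = "insert {#x, y, z#} C"
    have c2: "card (shadow 2 ?C) = Suc (card (shadow 2 C))"
      unfolding sh using new fin by (simp add: finite_shadow)
    have c: "card ?C = Suc (card C)" using new_triple[OF new] fin by simp
    have "\<exists>D. uniform 3 D \<and> card (verts D) = a \<and> card (shadow 2 D) = b \<and>
      card D = card ?C + (b - card (shadow 2 ?C))"
      by (rule Suc.hyps(1)) (use Suc.hyps(2) Suc.prems c2 ex in \<open>auto simp: uniform_insert_triple\<close>)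
    then show ?thesis using c c2 Suc.hyps(2) by auto
  qed
  show ?case
  proof (cases "card (verts C) < a")
    case True
    obtain y where y: "y \<notin> verts C" using fresh_vertex[OF fin] .
    show ?thesis
    proof (rule step[of y y y])
      show "{#y, y#} \<notin> shadow 2 C" using y by (simp add: pair_not_in_shadow)
      show "shadow 2 (insert {#y, y, y#} C) = insert {#y, y#} (shadow 2 C)"
        by (simp add: shadow_insert_triple)
      have "card (verts (insert {#y, y, y#} C)) = Suc (card (verts C))"
        using y finite_verts[OF fin] by (simp add: verts_insert)
      then show "card (verts (insert {#y, y, y#} C)) \<le> a"
        "Suc (card (shadow 2 C)) + a \<le> b + card (verts (insert {#y, y, y#} C))"
        using True Suc.prems by auto
    qed
  next
    case False
    then have va: "card (verts C) = a" using Suc.prems by simp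
    have "\<exists>K. K \<in> pairs (verts C) \<and> K \<notin> shadow 2 C"
    proof (rule ccontr)
      assume "\<not> ?thesis"
      then have "pairs (verts C) \<subseteq> shadow 2 C" by blast
      then have "triangle a \<le> card (shadow 2 C)"
        using card_mono[OF finite_shadow[OF fin]] card_pairs[OF finite_verts[OF fin]] va by metis
      then show False using Suc.prems Suc.hyps(2) by linarith
    qed
    then obtain x y where xy: "x \<in> verts C" "y \<in> verts C" "{#x, y#} \<notin> shadow 2 C"
      by (auto simp: pairs_def elim!: size2E)
    show ?thesis
    proof (cases "{#x, x#} \<in> shadow 2 C")
      case True
      show ?thesis
      proof (rule step[of x y x])
        show "shadow 2 (insert {#x, y, x#} C) = insert {#x, y#} (shadow 2 C)"
          using True by (auto simp: shadow_insert_triple add_mset_commute)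
        have "verts (insert {#x, y, x#} C) = verts C" using xy by (auto simp: verts_insert)
        then show "card (verts (insert {#x, y, x#} C)) \<le> a"
          "Suc (card (shadow 2 C)) + a \<le> b + card (verts (insert {#x, y, x#} C))"
          using va Suc.prems Suc.hyps(2) by auto
      qed (use xy in auto)
    next
      case False
      show ?thesis
      proof (rule step[of x x x])
        show "shadow 2 (insert {#x, x, x#} C) = insert {#x, x#} (shadow 2 C)"
          by (auto simp: shadow_insert_triple)
        have "verts (insert {#x, x, x#} C) = verts C" using xy by (auto simp: verts_insert)
        then show "card (verts (insert {#x, x, x#} C)) \<le> a"
          "Suc (card (shadow 2 C)) + a \<le> b + card (verts (insert {#x, x, x#} C))"
          using va Suc.prems Suc.hyps(2) by auto
      qed (use False in auto)
    qed
  qed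
qed

text \<open>
  Dropping a generator from \<open>D\<close> and completing changes the number of generators by the number of
  lost edges minus 1, hence by at most 2. A jump by 2 means that \<open>x y z\<close> was dropped and lost all
  three of its edges; the value skipped is obtained by adding \<open>x x y\<close> to \<open>D\<close> if all loops at
  \<open>x\<close>, \<open>y\<close>, \<open>z\<close> survive, and by replacing \<open>x y z\<close> with \<open>u u v\<close> if the loop at \<open>u\<close> is missing.
\<close>

lemma interval_below_shadow:
  assumes C: "uniform 3 C" and c: "card C \<le> c" "c \<le> card (shadow 2 C)"
  shows "\<exists>D. uniform 3 D \<and> card (verts D) = card (verts C) \<and>
    card (shadow 2 D) = card (shadow 2 C) \<and> card D = c"
proof -
  define a where "a = card (verts C)"
  define b where "b = card (shadow 2 C)"
  have fin: "finite C" using C by (simp add: uniform_def)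
  have btri: "b \<le> triangle a" using card_shadow_le_triangle[OF fin] by (simp add: a_def b_def)
  \<comment> \<open>The number of generators that \<open>completion\<close> produces from
    \<open>D\<close>.\<close>
  define val where "val D = card D + (b - card (shadow 2 D))" for D
  have part: "uniform 3 D" "card (shadow 2 D) + a \<le> b + card (verts D)"
    "card (verts D) \<le> a" "card (shadow 2 D) \<le> b" if "D \<subseteq> C" for D
    using that C shadow_excess_mono[OF C that] card_mono[OF finite_verts[OF fin] verts_mono[OF that]]
      card_mono[OF finite_shadow[OF fin] shadow_mono[OF that]]
    by (auto simp: uniform_def a_def b_def intro: finite_subset)
  let ?goal = "\<exists>D. uniform 3 D \<and> card (verts D) = a \<and> card (shadow 2 D) = b \<and> card D = c"
  have completed: ?goal if "uniform 3 D" "card (shadow 2 D) + a \<le> b + card (verts D)"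
    "card (verts D) \<le> a" "card (shadow 2 D) \<le> b" "val D = c" for D
    using completion[OF that(1-4) btri] that(5) by (auto simp: val_def)
  \<comment> \<open>Since \<open>C\<close> itself has value \<open>card C <= c\<close>, a smallest
    subset of value at most \<open>c\<close> exists; the empty set has value
    \<open>b >= c\<close>.\<close>
  define P where "P n \<longleftrightarrow> (\<exists>D\<subseteq>C. card D = n \<and> val D \<le> c)" for n
  have "P (card C)" using c by (auto simp: P_def val_def b_def)
  then obtain n where n: "P n" "\<And>m. m < n \<Longrightarrow> \<not> P m" by (metis exists_least_iff)
  then obtain D where D: "D \<subseteq> C" "card D = n" "val D \<le> c" by (auto simp: P_def)
  have finD: "finite D" using D fin finite_subset by blast
  have ?goal
  proof (cases "val D = c")
    case True
    then show ?thesis using completed[OF part[OF D(1)]] by simp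
  next
    case False
    have "val {} = b" by (simp add: val_def shadow_def)
    then have "D \<noteq> {}" using False D c by (auto simp: b_def)
    then obtain M where M: "M \<in> D" by blast
    define D' where "D' = D - {M}"
    have D': "D' \<subseteq> C" "D = insert M D'" "M \<notin> D'" "finite D'"
      using D M finD by (auto simp: D'_def)
    then have cD': "card D = Suc (card D')" by simp
    have gt: "val D' > c" using n(2)[of "card D'"] D D' by (auto simp: P_def not_le)
    have "size M = 3" using C M D by (auto simp: uniform_def)
    then obtain x y z where xyz: "M = {#x, y, z#}" by (rule size3E)
    define T where "T = {{#x, y#}, {#x, z#}, {#y, z#}}"
    have shD: "shadow 2 D = T \<union> shadow 2 D'" unfolding D'(2) xyz T_def by (rule shadow_insert_triple)
    have "card T \<le> 3" unfolding T_def by (simp add: card_insert_if)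
    moreover have "T - shadow 2 D' \<subseteq> T" "finite T" by (auto simp: T_def)
    moreover have cD: "card (shadow 2 D) = card (shadow 2 D') + card (T - shadow 2 D')"
    proof -
      have "shadow 2 D = shadow 2 D' \<union> (T - shadow 2 D')" using shD by auto
      then show ?thesis using D' by (metis Diff_disjoint card_Un_disjoint finite_Diff finite_shadow calculation(3))
    qed
    \<comment> \<open>Dropping \<open>M\<close> changes the value from below \<open>c\<close> to
      above \<open>c\<close>, a jump of at least 2, and the jump is the number of lost edges minus
      1.\<close>
    moreover have "card (T - shadow 2 D') \<ge> 3"
      using gt D(3) False cD' part(4)[OF D(1)] cD by (simp add: val_def)
    ultimately have T: "card T = 3" "T \<inter> shadow 2 D' = {}"
      using card_mono[of T "T - shadow 2 D'"] card_subset_eq[of T "T - shadow 2 D'"] by auto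
    have neq: "x \<noteq> y" "x \<noteq> z" "y \<noteq> z"
      using T(1) by (auto simp: T_def card_insert_if add_mset_commute split: if_splits)
    have c3: "card (shadow 2 D) = card (shadow 2 D') + 3" using cD T by (simp add: Diff_triv)
    have vc: "val D + 1 = c" "val D' = c + 1"
      using gt False D(3) cD' c3 part(4)[OF D(1)] by (auto simp: val_def)
    show ?thesis
    proof (cases "\<forall>u\<in>{x, y, z}. {#u, u#} \<in> shadow 2 D'")
      case True
      let ?E = "insert {#x, x, y#} D"
      have xy: "{#x, y#} \<notin> shadow 2 D'" using T(2) by (auto simp: T_def)
      then have "{#x, x, y#} \<notin> D'" using edge_in_triple(2) by blast
      moreover have "{#x, x, y#} \<noteq> M" using neq unfolding xyz by (auto simp: pair_eq_iff)
      ultimately have notin: "{#x, x, y#} \<notin> D" using D'(2) by blast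
      have "shadow 2 ?E = shadow 2 D"
        using True shD by (auto simp: shadow_insert_triple T_def)
      moreover have "verts ?E = verts D" using D'(2) xyz by (auto simp: verts_insert)
      moreover have "card ?E = Suc (card D)" using notin finD by simp
      ultimately show ?thesis
        using completed[of ?E] part[OF D(1)] vc by (simp add: uniform_insert_triple val_def)
    next
      case False
      then obtain u where u: "u \<in> {x, y, z}" "{#u, u#} \<notin> shadow 2 D'" by blast
      then obtain v w where vw: "set_mset M = {u, v, w}" "v \<noteq> u" "{#u, v#} \<in> T"
        using neq xyz by (auto simp: T_def add_mset_commute)
      let ?E = "insert {#u, u, v#} D'"
      have uv: "{#u, v#} \<notin> shadow 2 D'" using vw T by blast
      then have "{#u, u, v#} \<notin> D'" using edge_in_triple(2) by blast
      then have cE: "card ?E = Suc (card D')" using D' by simp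
      have "shadow 2 ?E = insert {#u, u#} (insert {#u, v#} (shadow 2 D'))"
        by (auto simp: shadow_insert_triple)
      then have sE: "card (shadow 2 ?E) = card (shadow 2 D') + 2"
        using u uv vw D' by (simp add: finite_shadow pair_eq_iff)
      \<comment> \<open>The third vertex \<open>w\<close> may disappear, but \<open>?E\<close> also
        has one edge fewer than \<open>D\<close>, so the excess condition of
        \<open>completion\<close> survives. One generator more and two edges more than
        \<open>D'\<close> give the value \<open>c\<close>.\<close>
      have sub: "verts ?E \<subseteq> verts D" "verts D \<subseteq> insert w (verts ?E)"
        using vw(1) unfolding D'(2) by (auto simp: verts_insert)
      have "card (verts D) \<le> Suc (card (verts ?E))"
        using card_mono[OF _ sub(2)] D' by (simp add: finite_verts card_insert_if split: if_splits)
      moreover have "card (verts ?E) \<le> card (verts D)"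
        using card_mono[OF _ sub(1)] finD by (simp add: finite_verts)
      ultimately show ?thesis
        using completed[of ?E] part[OF D(1)] part(1)[OF D'(1)] vc sE cE c3
        by (simp add: uniform_insert_triple val_def)
    qed
  qed
  then show ?thesis by (simp add: a_def b_def)
qed

lemma triangle_mono: "m \<le> n \<Longrightarrow> triangle m \<le> triangle n"
  using triangle_add[of m "n - m"] by simp

lemma pairs_mono: "S \<subseteq> T \<Longrightarrow> pairs S \<subseteq> pairs T"
  by (auto simp: pairs_def)

lemma sorted_triple_eq:
  fixes i m k :: nat
  assumes "{#i, m, k#} = {#i', m', k'#}" "i \<le> m" "m \<le> k" "i' \<le> m'" "m' \<le> k'"
  shows "i = i' \<and> m = m' \<and> k = k'"
proof -
  have "mset [i, m, k] = mset [i', m', k']" using assms by simp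
  then have "sort [i, m, k] = sort [i', m', k']" by (metis sorted_list_of_multiset_mset)
  moreover have "sort [i, m, k] = [i, m, k]" "sort [i', m', k'] = [i', m', k']"
    using assms by (simp_all add: sort_key_id_if_sorted)
  ultimately show ?thesis by simp
qed

text \<open>The vertex \<open>x\<close> is joined to all \<open>a\<close> vertices including itself,
  and the other \<open>g\<close> edges form an initial segment \<open>H\<close> of the
  colexicographic order below \<open>x\<close>. Multiplying every edge by \<open>x\<close> gives
  \<open>b\<close> generators without further edges; the \<open>growth g\<close> triples with all
  pairs in \<open>H\<close> can then be added freely.\<close>

lemma interval_above_shadow:
  assumes a: "1 \<le> a" "a \<le> b" "b \<le> triangle a" and c: "b \<le> c" "c \<le> b + growth (b - a)"
  shows "\<exists>D. uniform 3 D \<and> card (verts D) = a \<and> card (shadow 2 D) = b \<and> card D = c"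
proof -
  define g where "g = b - a"
  define x where "x = a - 1"
  have ax: "a = Suc x" using a by (simp add: x_def)
  have gtri: "g \<le> triangle x" using a by (simp add: g_def ax)
  define H where "H = (\<lambda>t. case prod_decode t of (m, n) \<Rightarrow> {#m, m + n#}) ` {..<g}"
  \<comment> \<open>A triple is recorded by its two largest factors, the \<open>t\<close>-th pair
    \<open>(m, m + n)\<close>, and its smallest factor \<open>i <= m\<close>; this leaves
    \<open>m + 1\<close> choices, the \<open>t\<close>-th summand of \<open>growth\<close>.\<close>
  define J0 where "J0 = (\<lambda>(t, i). case prod_decode t of (m, n) \<Rightarrow> {#i, m, m + n#}) `
    (SIGMA t:{..<g}. {..fst (prod_decode t)})"
  have dec: "triangle (m + n) + m = t" if "prod_decode t = (m, n)" for t m n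
    using prod_decode_inverse[of t] that by (simp add: prod_encode_def)
  have small: "m + n < x" if "prod_decode t = (m, n)" "t < g" for t m n
    using dec[OF that(1)] that(2) gtri triangle_mono[of x "m + n"] by linarith
  have inH: "{#i, k#} \<in> H" if "i \<le> k" "triangle k + i < g" for i k
  proof -
    have "prod_encode (i, k - i) = triangle k + i" using that by (simp add: prod_encode_def)
    then have "prod_decode (triangle k + i) = (i, k - i)" by (metis prod_encode_inverse)
    then show ?thesis using that by (force simp: H_def intro!: image_eqI[of _ _ "triangle k + i"])
  qed
  have "inj_on (\<lambda>t. case prod_decode t of (m, n) \<Rightarrow> {#m, m + n#}) {..<g}"
  proof (rule inj_onI)
    fix s t
    assume eq: "(case prod_decode s of (m, n) \<Rightarrow> {#m, m + n#}) = (case prod_decode t of (m, n) \<Rightarrow> {#m, m + n#})"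
    obtain m n m' n' where mn: "prod_decode s = (m, n)" "prod_decode t = (m', n')"
      by (cases "prod_decode s", cases "prod_decode t")
    then have "m = m' \<and> n = n'" using eq by (auto simp: pair_eq_iff)
    then show "s = t" using mn by (metis prod_decode_inverse)
  qed
  then have cardH: "card H = g" by (simp add: H_def card_image)
  have "inj_on (\<lambda>(t, i). case prod_decode t of (m, n) \<Rightarrow> {#i, m, m + n#})
    (SIGMA t:{..<g}. {..fst (prod_decode t)})"
  proof (rule inj_onI, clarify)
    fix s i t j
    assume le: "i \<le> fst (prod_decode s)" "j \<le> fst (prod_decode t)"
      and eq: "(case prod_decode s of (m, n) \<Rightarrow> {#i, m, m + n#}) = (case prod_decode t of (m, n) \<Rightarrow> {#j, m, m + n#})"
    obtain m n m' n' where mn: "prod_decode s = (m, n)" "prod_decode t = (m', n')"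
      by (cases "prod_decode s", cases "prod_decode t")
    then have "i = j \<and> m = m' \<and> m + n = m' + n'"
      using eq le by (intro sorted_triple_eq) auto
    then show "s = t \<and> i = j" using mn by (metis prod_decode_inverse add_left_cancel)
  qed
  then have "card J0 = growth g" unfolding J0_def by (simp add: card_image growth_def)
  moreover have "c - b \<le> growth g" using c by (simp add: g_def)
  ultimately obtain J where J: "J \<subseteq> J0" "card J = c - b" "finite J"
    by (metis obtain_subset_with_card_n)
  \<comment> \<open>The pairs formed with the smallest factor \<open>i\<close> do not come after the
    pair of the two largest factors, so they lie in the initial segment \<open>H\<close>.\<close>
  have J_E: "\<exists>i m k. M = {#i, m, k#} \<and> {#i, m#} \<in> H \<and> {#i, k#} \<in> H \<and> {#m, k#} \<in> H"
    if M: "M \<in> J" for M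
  proof -
    from M J obtain t i where t: "t < g" "i \<le> fst (prod_decode t)"
      and M': "M = (case prod_decode t of (m, n) \<Rightarrow> {#i, m, m + n#})"
      by (auto simp: J0_def)
    obtain m n where mn: "prod_decode t = (m, n)" by (cases "prod_decode t")
    note d = dec[OF mn]
    have "{#i, m#} \<in> H"
      using t mn d triangle_mono[of m "m + n"] by (intro inH) auto
    moreover have "{#i, m + n#} \<in> H"
      using t mn d by (intro inH) auto
    moreover have "{#m, m + n#} \<in> H"
      using t mn d by (intro inH) auto
    ultimately show ?thesis using M' mn by auto
  qed
  have H_sub: "H \<subseteq> pairs {..<x}"
  proof
    fix N assume "N \<in> H"
    then obtain t where t: "t < g" "N = (case prod_decode t of (m, n) \<Rightarrow> {#m, m + n#})"
      by (auto simp: H_def)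
    obtain m n where mn: "prod_decode t = (m, n)" by (cases "prod_decode t")
    then show "N \<in> pairs {..<x}" using small[OF mn t(1)] t(2) by (simp add: pairs_def)
  qed
  define S where "S = (\<lambda>w. {#x, w#}) ` {..<a}"
  define E where "E = S \<union> H"
  have xin: "x \<in># N" if "N \<in> S" for N using that by (auto simp: S_def)
  have "S \<inter> H = {}" using H_sub xin by (fastforce simp: pairs_def)
  moreover have "card S = a" unfolding S_def by (subst card_image) (auto simp: inj_on_def)
  ultimately have cardE: "card E = b" and finE: "finite E"
    using cardH a by (auto simp: E_def card_Un_disjoint S_def H_def g_def)
  have E_sub: "E \<subseteq> pairs {..<a}"
    using H_sub pairs_mono[of "{..<x}" "{..<a}"] by (auto simp: E_def S_def ax, auto simp: pairs_def)
  define C where "C = add_mset x ` E \<union> J"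
  have disj: "add_mset x ` E \<inter> J = {}"
  proof -
    have "x \<notin># M" if MJ: "M \<in> J" for M
    proof -
      obtain i m k where M: "M = {#i, m, k#}" "{#i, m#} \<in> H" "{#i, k#} \<in> H"
        using J_E[OF MJ] by blast
      then have "{#i, m#} \<in> pairs {..<x}" "{#i, k#} \<in> pairs {..<x}" using H_sub by blast+
      then show ?thesis by (auto simp: M(1) pairs_def)
    qed
    moreover have "x \<in># M" if "M \<in> add_mset x ` E" for M using that by auto
    ultimately show ?thesis by blast
  qed
  have "card (add_mset x ` E) = b" using cardE by (simp add: card_image inj_on_def)
  then have cardC: "card C = c" using disj finE J c by (simp add: C_def card_Un_disjoint)
  have "size M = 3" if "M \<in> C" for M
    using that E_sub J_E by (fastforce simp: C_def pairs_def)
  then have uC: "uniform 3 C" using finE J by (simp add: uniform_def C_def)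
  have "shadow 2 C = E"
  proof
    show "E \<subseteq> shadow 2 C"
    proof
      fix N assume N: "N \<in> E"
      then have "size N = 2" using E_sub by (auto simp: pairs_def)
      moreover have "N \<subseteq># add_mset x N" by (rule subset_mset.less_imp_le) simp
      moreover have "add_mset x N \<in> C" using N by (simp add: C_def)
      ultimately show "N \<in> shadow 2 C"
        unfolding shadow_def by (intro CollectI conjI bexI[of _ "add_mset x N"])
    qed
    show "shadow 2 C \<subseteq> E"
    proof
      fix N assume "N \<in> shadow 2 C"
      then obtain M where N: "size N = 2" "N \<subseteq># M" "M \<in> C" by (auto simp: shadow_def)
      obtain i m k where M: "M = {#i, m, k#}" "{#i, m#} \<in> E" "{#i, k#} \<in> E" "{#m, k#} \<in> E"
      proof (cases "M \<in> J")
        case True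
        obtain i m k where "M = {#i, m, k#}" "{#i, m#} \<in> H" "{#i, k#} \<in> H" "{#m, k#} \<in> H"
          using J_E[OF True] by blast
        then show ?thesis using that unfolding E_def by blast
      next
        case False
        then obtain K where K: "K \<in> E" "M = add_mset x K" using N by (auto simp: C_def)
        then have sK: "size K = 2" "set_mset K \<subseteq> {..<a}" using E_sub by (auto simp: pairs_def)
        then obtain u w where "K = {#u, w#}" by (auto elim: size2E)
        then show ?thesis using K sK by (intro that[of x u w]) (auto simp: E_def S_def)
      qed
      have "N \<in> {{#i, m#}, {#i, k#}, {#m, k#}}"
        using divisors_triple[of i m k] N M(1) by blast
      then show "N \<in> E" using M by auto
    qed
  qed
  moreover have "verts C = {..<a}"
  proof
    have "\<Union> (set_mset ` J) \<subseteq> {..<a}"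
    proof clarify
      fix M v assume M: "M \<in> J" "v \<in># M"
      obtain i m k where imk: "M = {#i, m, k#}" "{#i, m#} \<in> H" "{#i, k#} \<in> H"
        using J_E[OF M(1)] by blast
      then have "{#i, m#} \<in> pairs {..<x}" "{#i, k#} \<in> pairs {..<x}" using H_sub by blast+
      then show "v < a" using M(2) by (auto simp: imk(1) pairs_def ax)
    qed
    then show "verts C \<subseteq> {..<a}" using E_sub ax by (auto simp: verts_def C_def pairs_def)
    show "{..<a} \<subseteq> verts C"
    proof
      fix w assume "w \<in> {..<a}"
      then have "add_mset x {#x, w#} \<in> C" unfolding C_def E_def S_def by blast
      then show "w \<in> verts C" unfolding verts_def by (rule UN_I) simp
    qed
  qed
  ultimately show ?thesis using uC cardC cardE by auto
qed

text \<open>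
  \<open>U\<close> holds the vertices not yet joined to \<open>y\<close>. A generator \<open>y u w\<close> uses up two of them and
  yields two or three new edges, depending on whether \<open>u w\<close> is already an edge.
\<close>

lemma cone_extension:
  assumes "uniform 3 C" "U \<subseteq> verts C - {y}" "{#y, y#} \<notin> shadow 2 C"
    "\<And>u. u \<in> U \<Longrightarrow> {#y, u#} \<notin> shadow 2 C" "r \<le> card U" "r = 0 \<Longrightarrow> y \<in> verts C"
  shows "\<exists>D. uniform 3 D \<and> verts D = insert y (verts C) \<and>
    card (shadow 2 D) = card (shadow 2 C) + r \<and> card D \<le> card C + (r + 1) div 2"
  using assms
proof (induction r arbitrary: C U rule: less_induct)
  case (less r)
  have fin: "finite C" using less.prems by (simp add: uniform_def)
  have finU: "finite U" using less.prems(2) finite_verts[OF fin] by (meson finite_Diff finite_subset)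
  have fs: "finite (shadow 2 C)" using fin by (rule finite_shadow)
  have ins: "card (insert M C) \<le> Suc (card C)" for M using fin by (simp add: card_insert_if)
  \<comment> \<open>The loop at \<open>y\<close> is saved for the end: \<open>y y y\<close> supplies
    one last edge and \<open>y y z\<close> supplies two. For \<open>r = 0\<close> nothing is added,
    so \<open>y\<close> must already occur.\<close>
  consider "r = 0" | "r = 1" | "r = 2" | "r \<ge> 3" by linarith
  then show ?case
  proof cases
    case 1
    then show ?thesis using less.prems by (intro exI[of _ C]) (auto simp: insert_absorb)
  next
    case 2
    have "card (shadow 2 (insert {#y, y, y#} C)) = card (shadow 2 C) + 1"
      using less.prems(3) fs by (simp add: shadow_insert_triple)
    then show ?thesis using less.prems(1) ins 2
      by (intro exI[of _ "insert {#y, y, y#} C"]) (auto simp: uniform_insert_triple verts_insert)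
  next
    case 3
    then have "U \<noteq> {}" using less.prems(5) by auto
    then obtain z where z: "z \<in> U" by blast
    have "{#y, y#} \<noteq> {#y, z#}" using z less.prems(2) by auto
    then have "card (shadow 2 (insert {#y, y, z#} C)) = card (shadow 2 C) + 2"
      using less.prems(3) less.prems(4)[OF z] fs by (simp add: shadow_insert_triple)
    moreover have "verts (insert {#y, y, z#} C) = insert y (verts C)"
      using z less.prems(2) by (auto simp: verts_insert)
    ultimately show ?thesis using less.prems(1) ins 3
      by (intro exI[of _ "insert {#y, y, z#} C"]) (auto simp: uniform_insert_triple)
  next
    case 4
    then obtain u where u: "u \<in> U" using less.prems(5) by fastforce
    have "card (U - {u}) > 0" using u 4 less.prems(5) by simp
    then have "U - {u} \<noteq> {}" by (metis card.empty less_irrefl)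
    then obtain w where w: "w \<in> U" "w \<noteq> u" by blast
    have yu: "u \<noteq> y" "w \<noteq> y" "u \<in> verts C" "w \<in> verts C" using u w less.prems(2) by auto
    let ?C = "insert {#y, u, w#} C"
    let ?k = "if {#u, w#} \<in> shadow 2 C then 2 else 3"
    have sh: "card (shadow 2 ?C) = card (shadow 2 C) + ?k"
      using less.prems(4)[OF u] less.prems(4)[OF w(1)] yu w fs
      by (auto simp: shadow_insert_triple card_insert_if pair_eq_iff)
    have v: "verts ?C = insert y (verts C)" using yu by (auto simp: verts_insert)
    have "\<exists>D. uniform 3 D \<and> verts D = insert y (verts ?C) \<and>
      card (shadow 2 D) = card (shadow 2 ?C) + (r - ?k) \<and> card D \<le> card ?C + ((r - ?k) + 1) div 2"
    proof (rule less.IH)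
      show "r - ?k < r" using 4 by simp
      show "uniform 3 ?C" using less.prems(1) by (simp add: uniform_insert_triple)
      show "U - {u, w} \<subseteq> verts ?C - {y}" using less.prems(2) v by auto
      show "{#y, y#} \<notin> shadow 2 ?C"
        using less.prems(3) yu by (auto simp: shadow_insert_triple pair_eq_iff)
      show "{#y, t#} \<notin> shadow 2 ?C" if "t \<in> U - {u, w}" for t
        using that less.prems(4) yu by (auto simp: shadow_insert_triple pair_eq_iff)
      have "card (U - {u, w}) = card U - 2" using u w by (simp add: card_Diff_subset)
      then show "r - ?k \<le> card (U - {u, w})" using less.prems(5) by auto
      show "y \<in> verts ?C" using v by simp
    qed
    then obtain D where D: "uniform 3 D" "verts D = insert y (verts ?C)"
      "card (shadow 2 D) = card (shadow 2 ?C) + (r - ?k)" "card D \<le> card ?C + ((r - ?k) + 1) div 2"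
      by blast
    \<comment> \<open>The new generator uses up at least two of the \<open>r\<close> edges, which
      lowers the rounded-up half by at least 1.\<close>
    have "((r - ?k) + 1) div 2 + 1 \<le> (r + 1) div 2" using 4 by auto
    then have "card D \<le> card C + (r + 1) div 2" using D(4) ins[of "{#y, u, w#}"] by linarith
    moreover have "card (shadow 2 D) = card (shadow 2 C) + r" using D(3) sh 4 by auto
    ultimately show ?thesis using D v by auto
  qed
qed

section \<open>Pure sequences and their generators\<close>

lemma shadow_0: "C \<noteq> {} \<Longrightarrow> shadow 0 C = {{#}}"
  by (auto simp: shadow_def)

text \<open>The generators are the monomials of top degree. A multiple of \<open>N\<close> in
  \<open>X\<close> of largest degree is maximal, and purity forces its degree to be
  \<open>e\<close>.\<close>

lemma pure_O_sequence_generators: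
  assumes "pure_O_sequence h" "length h = Suc e"
  obtains C where "uniform e C" "C \<noteq> {}" "\<And>i. i \<le> e \<Longrightarrow> h ! i = card (shadow i C)"
proof -
  obtain r X where rX: "pure_order_ideal r X" and h: "h = h_vector X"
    using assms(1) unfolding pure_O_sequence_def by blast
  have oi: "order_ideal r X" using rX unfolding pure_order_ideal_def by (rule conjunct1)
  have X: "finite X" "X \<noteq> {}" using oi by (simp_all add: order_ideal_def)
  have down: "N \<in> X" if "M \<in> X" "N \<subseteq># M" for M N
    using oi that unfolding order_ideal_def by blast
  have pure: "size M = size N" if "M \<in> maximal_monomials X" "N \<in> maximal_monomials X" for M N
    using rX that unfolding pure_order_ideal_def by blast
  have e: "Max (size ` X) = e" using assms(2) h by (simp add: h_vector_def)
  have le: "size M \<le> e" if "M \<in> X" for M using e X that by auto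
  have "e \<in> size ` X" using e X by (metis Max_in finite_imageI image_is_empty)
  then obtain T where T: "T \<in> X" "size T = e" by blast
  have eq_if_size_le: "K = M" if "K \<in> X" "M \<subseteq># K" "size K \<le> size M" for K M
    using subseteq_size_eq[OF that(2)] size_mset_mono[OF that(2)] that(3) by simp
  have Tmax: "T \<in> maximal_monomials X"
    unfolding maximal_monomials_def using T le eq_if_size_le by simp
  define C where "C = {M \<in> X. size M = e}"
  have below: "\<exists>M\<in>C. N \<subseteq># M" if N: "N \<in> X" for N
  proof -
    let ?A = "{M \<in> X. N \<subseteq># M}"
    have "finite ?A" "?A \<noteq> {}" using N X by auto
    then have "Max (size ` ?A) \<in> size ` ?A" by (intro Max_in) auto
    then obtain M where M: "M \<in> ?A" "size M = Max (size ` ?A)" by (elim imageE) auto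
    have "M \<in> maximal_monomials X"
      unfolding maximal_monomials_def
    proof (intro CollectI conjI ballI impI)
      fix K assume K: "K \<in> X" "M \<subseteq># K"
      then have "K \<in> ?A" using M by (auto intro: subset_mset.order_trans)
      then have "size K \<le> size M" unfolding M(2) using \<open>finite ?A\<close> by simp
      then show "K = M" using K eq_if_size_le by simp
    qed (use M in simp)
    then have "size M = e" using pure Tmax T by metis
    then show ?thesis using M by (auto simp: C_def)
  qed
  have "h ! i = card (shadow i C)" if "i \<le> e" for i
  proof -
    have "shadow i C = {M \<in> X. size M = i}"
      using below down by (auto simp: shadow_def C_def)
    then show ?thesis unfolding h h_vector_def e using that by (simp del: upt_Suc)
  qed
  moreover have "uniform e C" using X by (simp add: uniform_def C_def)
  moreover have "C \<noteq> {}" using T by (auto simp: C_def)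
  ultimately show thesis using that by blast
qed

text \<open>The divisors of elements of \<open>C\<close> form an order ideal, and a maximal one
  equals the generator it divides, so it has degree \<open>e\<close>.\<close>

lemma pure_O_sequence_of_generators:
  assumes C: "uniform e C" "C \<noteq> {}" and h: "length h = Suc e"
    "\<And>i. i \<le> e \<Longrightarrow> h ! i = card (shadow i C)"
  shows "pure_O_sequence h"
proof -
  \<comment> \<open>shifts the indices, since monomials only use \<open>y\<^sub>1, y\<^sub>2, \<dots>\<close>\<close>
  define f :: "monomial \<Rightarrow> monomial" where "f = image_mset Suc"
  have inj: "inj f" unfolding f_def by (simp add: multiset.inj_map)
  define Y where "Y = {N. \<exists>M\<in>C. N \<subseteq># M}"
  define X where "X = f ` Y"
  have fin: "finite C" and sz: "\<And>M. M \<in> C \<Longrightarrow> size M = e" using C by (auto simp: uniform_def)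
  have "finite Y" unfolding Y_def by (rule finite_subset[of _ "\<Union>M\<in>C. {N. N \<subseteq># M}"])
    (use fin in \<open>auto simp: finite_divisors\<close>)
  then have finX: "finite X" by (simp add: X_def)
  have CY: "C \<subseteq> Y" by (auto simp: Y_def)
  obtain r where r: "\<And>v. v \<in> verts C \<Longrightarrow> v < r"
    using finite_verts[OF fin, unfolded finite_nat_set_iff_bounded] by blast
  have "X \<subseteq> monomials r"
  proof
    fix N assume "N \<in> X"
    then obtain K M where K: "N = f K" "K \<subseteq># M" "M \<in> C" by (auto simp: X_def Y_def)
    then have "set_mset K \<subseteq> verts C" by (auto simp: verts_def dest: set_mset_mono)
    then show "N \<in> monomials r" using r by (force simp: K(1) f_def monomials_def Suc_le_eq)
  qed
  moreover have "N \<in> X" if M: "M \<in> X" and N: "N \<subseteq># M" for M N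
  proof -
    obtain K where K: "M = f K" "K \<in> Y" using M by (auto simp: X_def)
    \<comment> \<open>Undoing the shift is exact on \<open>N\<close>, because all indices in
      \<open>M = f K\<close> are positive.\<close>
    let ?N = "image_mset (\<lambda>x. x - 1) N"
    have "?N \<subseteq># image_mset (\<lambda>x. x - 1) M" using N by (rule image_mset_subseteq_mono)
    then have "?N \<subseteq># K" by (simp add: K(1) f_def multiset.map_comp comp_def)
    then have "?N \<in> Y" using K(2) by (auto simp: Y_def intro: subset_mset.order_trans)
    moreover have "f ?N = N"
    proof -
      have "f ?N = image_mset (\<lambda>x. x) N"
        unfolding f_def multiset.map_comp
      proof (rule image_mset_cong)
        fix x assume "x \<in># N"
        then have "x \<in># M" using N by (meson mset_subset_eqD)
        then show "(Suc \<circ> (\<lambda>x. x - 1)) x = x" by (auto simp: K(1) f_def)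
      qed
      then show ?thesis by simp
    qed
    ultimately show ?thesis unfolding X_def by force
  qed
  moreover have "X \<noteq> {}" using C CY by (auto simp: X_def)
  ultimately have oi: "order_ideal r X" using finX unfolding order_ideal_def by blast
  have max_size: "size M = e" if "M \<in> maximal_monomials X" for M
  proof -
    from that obtain N K where N: "M = f N" "N \<subseteq># K" "K \<in> C"
      by (auto simp: maximal_monomials_def X_def Y_def)
    then have "f K \<in> X" "M \<subseteq># f K"
      using CY by (auto simp: X_def f_def intro: image_mset_subseteq_mono)
    then have "M = f K" using that by (auto simp: maximal_monomials_def)
    then show ?thesis using sz[OF N(3)] by (simp add: f_def)
  qed
  have levels: "{M \<in> X. size M = i} = f ` shadow i C" for i
    by (auto simp: X_def Y_def shadow_def f_def)
  have "Max (size ` X) = e"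
  proof (rule Max_eqI)
    fix k assume "k \<in> size ` X"
    then show "k \<le> e" using sz by (auto simp: X_def Y_def f_def dest!: size_mset_mono)
  next
    obtain M where "M \<in> C" using C by blast
    then have "f M \<in> X" "size (f M) = e" using CY sz by (auto simp: X_def f_def)
    then show "e \<in> size ` X" by force
  qed (use finX in simp)
  then have "h = h_vector X"
    using h by (intro nth_equalityI)
      (auto simp: h_vector_def levels card_image inj_on_subset[OF inj] simp del: upt_Suc)
  moreover have "pure_order_ideal r X"
    using oi max_size by (simp add: pure_order_ideal_def)
  ultimately show ?thesis by (auto simp: pure_O_sequence_def)
qed

section \<open>Shifted sums\<close>

lemma length_shifted_sum: "length h = Suc e \<Longrightarrow> length (shifted_sum h h') = Suc e"
  by (simp add: shifted_sum_def)

lemma nth_shifted_sum: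
  "0 < i \<Longrightarrow> i < length h \<Longrightarrow> shifted_sum h h' ! i = h ! i + h' ! (i - 1)"
  by (cases i) (auto simp: shifted_sum_def simp del: upt_Suc)

lemma pure_shifted_sum:
  assumes "uniform e D" "D \<noteq> {}" "length h = Suc e"
    "\<And>i. 0 < i \<Longrightarrow> i \<le> e \<Longrightarrow> h ! i + h' ! (i - 1) = card (shadow i D)"
  shows "pure_O_sequence (shifted_sum h h')"
proof (rule pure_O_sequence_of_generators[OF assms(1,2)])
  show "length (shifted_sum h h') = Suc e" using assms by (simp add: length_shifted_sum)
  show "shifted_sum h h' ! i = card (shadow i D)" if "i \<le> e" for i
  proof (cases "i = 0")
    case True
    then show ?thesis using assms(2) by (simp add: shifted_sum_def shadow_0)
  next
    case False
    then show ?thesis using assms that by (simp add: nth_shifted_sum)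
  qed
qed

text \<open>Joining a fresh vertex to \<open>p\<close> old ones adds exactly \<open>p\<close>
  edges.\<close>

lemma shifted_sum_degree_2:
  assumes C: "uniform 2 C" "C \<noteq> {}" and p: "p \<le> card (verts C)"
  shows "\<exists>D. uniform 2 D \<and> D \<noteq> {} \<and> card (verts D) = card (verts C) + (if p = 0 then 0 else 1) \<and>
    card D = card C + p"
proof -
  have fin: "finite C" using C by (simp add: uniform_def)
  obtain y where y: "y \<notin> verts C" using fresh_vertex[OF fin] .
  obtain S where S: "S \<subseteq> verts C" "card S = p" "finite S"
    using obtain_subset_with_card_n[OF p] by metis
  define B where "B = (\<lambda>s. {#y, s#}) ` S"
  have "card B = p" using S unfolding B_def by (subst card_image) (auto simp: inj_on_def)
  moreover have "C \<inter> B = {}" using y by (auto simp: B_def verts_def)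
  ultimately have "card (C \<union> B) = card C + p"
    using fin S by (simp add: card_Un_disjoint B_def)
  moreover have "verts (C \<union> B) = (if p = 0 then verts C else insert y (verts C))"
    using S by (auto simp: verts_def B_def)
  moreover have "uniform 2 (C \<union> B)" using C S by (auto simp: uniform_def B_def)
  ultimately show ?thesis using y finite_verts[OF fin] C by (intro exI[of _ "C \<union> B"]) auto
qed

text \<open>The first two conditions on \<open>q\<close> hold for a graph with \<open>p\<close>
  vertices, none isolated, and \<open>q\<close> edges; the third is the difference inequality in
  degree 2. The cases are whether the target \<open>card C + q\<close> is at most the new number of
  edges \<open>b + p\<close> or above it.\<close>

lemma shifted_sum_degree_3:
  assumes C: "uniform 3 C" and p: "1 \<le> p" "p \<le> card (verts C)"
    and q: "p \<le> 2 * q" "q \<le> triangle p" "q + card (verts C) \<le> p + card (shadow 2 C)"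
  shows "\<exists>D. uniform 3 D \<and> card (verts D) = card (verts C) + 1 \<and>
    card (shadow 2 D) = card (shadow 2 C) + p \<and> card D = card C + q"
proof -
  define a where "a = card (verts C)"
  define b where "b = card (shadow 2 C)"
  have fin: "finite C" using C by (simp add: uniform_def)
  have ab: "a \<le> b" unfolding a_def b_def using C by (rule card_verts_le_shadow)
  have b: "b \<le> triangle a" unfolding a_def b_def using fin by (rule card_shadow_le_triangle)
  have c: "card C \<le> b + growth (b - a)" unfolding a_def b_def using C by (rule card_triples_le)
  show ?thesis
  proof (cases "card C + q \<le> b + p")
    case True
    obtain y where y: "y \<notin> verts C" using fresh_vertex[OF fin] .
    obtain D where D: "uniform 3 D" "verts D = insert y (verts C)"
      "card (shadow 2 D) = b + p" "card D \<le> card C + (p + 1) div 2"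
      using cone_extension[OF C, of "verts C" y p] y p by (auto simp: pair_not_in_shadow b_def)
    have "card (verts D) = a + 1" using D(2) y finite_verts[OF fin] by (simp add: a_def)
    \<comment> \<open>The cone costs at most half of \<open>p\<close>, rounded up, which
      \<open>p <= 2 * q\<close> bounds by \<open>q\<close>.\<close>
    moreover have "card D \<le> card C + q" using D(4) q(1) by linarith
    ultimately show ?thesis
      using interval_below_shadow[OF D(1), of "card C + q"] D(3) True by (simp add: a_def b_def)
  next
    case False
    \<comment> \<open>One new vertex and \<open>p\<close> new edges raise the excess by
      \<open>n = p - 1\<close>. As \<open>triangle p = triangle n + p\<close>, the conditions bound
      \<open>q - p\<close> by both terms of the minimum in \<open>growth_window\<close>.\<close>
    define n where "n = p - 1"
    have n: "p = Suc n" using p by (simp add: n_def)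
    have ex: "b + p - (a + 1) = (b - a) + n" using n ab by simp
    have "q \<le> triangle n + p" using q(2) n by simp
    moreover have "q \<le> b - a + n + p" using q(3) ab by (simp add: a_def b_def)
    ultimately have "card C + q \<le> (b + p) + growth (b + p - (a + 1))"
      unfolding ex using growth_window[of "b - a" n] c by linarith
    moreover have "b + p \<le> triangle (a + 1)" using b p by (simp add: a_def)
    ultimately show ?thesis
      using interval_above_shadow[of "a + 1" "b + p" "card C + q"] False ab p
      by (simp add: a_def b_def)
  qed
qed

lemma card_set_mset_le_size: "card (set_mset M) \<le> size M"
  by (induction M) (auto simp: card_insert_if)

lemma card_verts_le:
  assumes "uniform k C"
  shows "card (verts C) \<le> k * card C"
proof -
  have fin: "finite C" using assms by (simp add: uniform_def)
  have "card (verts C) \<le> (\<Sum>M\<in>C. card (set_mset M))"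
    unfolding verts_def using fin by (rule card_UN_le)
  also have "\<dots> \<le> (\<Sum>M\<in>C. k)"
    by (rule sum_mono) (use assms in \<open>auto simp: uniform_def card_set_mset_le_size\<close>)
  finally show ?thesis by (simp add: mult.commute)
qed

theorem theorem3p9:
  fixes e :: nat and h h' :: "nat list"
  assumes "1 \<le> e" and "e \<le> 3"
    and "pure_O_sequence h" and "length h = e + 1"
    and "pure_O_sequence h'" and "length h' = e"
    and "\<forall>i. int i \<le> \<lceil>real e / 2\<rceil> \<and> i < length h' \<longrightarrow>
           first_difference h' ! i \<le> first_difference h ! i"
    and "\<forall>i \<le> e - 1. h' ! i \<le> h ! i"
  shows "pure_O_sequence (shifted_sum h h')"
proof -
  have len: "length h = Suc e" "length h' = Suc (e - 1)" using assms(1,4,6) by auto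
  obtain C where C: "uniform e C" "C \<noteq> {}" "\<And>i. i \<le> e \<Longrightarrow> h ! i = card (shadow i C)"
    using pure_O_sequence_generators[OF assms(3) len(1)] by metis
  obtain C' where C': "uniform (e - 1) C'" "C' \<noteq> {}"
    "\<And>i. i \<le> e - 1 \<Longrightarrow> h' ! i = card (shadow i C')"
    using pure_O_sequence_generators[OF assms(5) len(2)] by metis
  have h1: "h ! 1 = card (verts C)" using C(3)[of 1] assms(1) card_shadow_1[of C] by simp
  have he: "h ! e = card C" using C(3)[of e] shadow_uniform[OF C(1)] by simp
  have h'0: "h' ! 0 = 1" using C'(3)[of 0] C'(2) by (simp add: shadow_0)
  have h'e: "h' ! (e - 1) = card C'" using C'(3)[of "e - 1"] shadow_uniform[OF C'(1)] by simp
  have finC': "finite C'" using C'(1) by (simp add: uniform_def)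
  have verts1: "1 \<le> card (verts C')" if "2 \<le> e"
  proof -
    obtain M where M: "M \<in> C'" using C'(2) by blast
    then have "set_mset M \<noteq> {}" using C'(1) that by (auto simp: uniform_def)
    then have "verts C' \<noteq> {}" using M by (auto simp: verts_def)
    then show ?thesis using finite_verts[OF finC'] by (simp add: Suc_le_eq card_gt_0_iff)
  qed
  have h'1: "h' ! 1 = card (verts C')" if "2 \<le> e"
    using C'(3)[of 1] that card_shadow_1[of C'] by simp
  consider "e = 1" | "e = 2" | "e = 3" using assms(1,2) by linarith
  then show ?thesis
  proof cases
    case 1
    \<comment> \<open>In degree 1 any set of variables works; \<open>{..h ! 1}\<close> has
      \<open>h ! 1 + 1\<close> elements.\<close>
    define D where "D = (\<lambda>i. {#i#}) ` {..h ! 1}"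
    have "uniform e D" using 1 by (auto simp: D_def uniform_def)
    moreover have "card D = h ! 1 + 1" unfolding D_def by (subst card_image) (auto simp: inj_on_def)
    ultimately show ?thesis
      using 1 h'0 len(1) shadow_uniform[of e D]
      by (intro pure_shifted_sum[of e D]) (auto simp: D_def le_Suc_eq)
  next
    case 2
    have "h' ! 1 \<le> card (verts C)" using spec[OF assms(8), of 1] 2 h1 by simp
    moreover have "h' ! 1 \<noteq> 0" using verts1 h'1 2 by simp
    ultimately obtain D where D: "uniform 2 D" "D \<noteq> {}" "card (verts D) = card (verts C) + 1"
      "card D = card C + h' ! 1"
      using shifted_sum_degree_2[of C "h' ! 1"] C(1,2) 2 by auto
    show ?thesis
    proof (rule pure_shifted_sum)
      show "uniform e D" using D(1) 2 by simp
      fix i assume "0 < i" "i \<le> e"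
      then consider "i = 1" | "i = 2" using 2 by linarith
      then show "h ! i + h' ! (i - 1) = card (shadow i D)"
        by cases (use D h1 he h'0 2 card_shadow_1[of D] shadow_uniform[OF D(1)] in simp_all)
    qed (use D len in auto)
  next
    case 3
    define p where "p = h' ! 1"
    define q where "q = h' ! 2"
    have pC': "p = card (verts C')" using h'1 3 by (simp add: p_def)
    have qC': "q = card C'" using h'e 3 by (simp add: q_def)
    have uC': "uniform 2 C'" using C'(1) 3 by simp
    have h2: "h ! 2 = card (shadow 2 C)" using C(3) 3 by simp
    \<comment> \<open>Every variable of \<open>C'\<close> lies on one of its \<open>q\<close> edges,
      each with at most two endpoints.\<close>
    have "p \<le> 2 * q" using card_verts_le[OF uC'] by (simp add: pC' qC')
    moreover have "q \<le> triangle p"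
      using card_shadow_le_triangle[OF finC'] shadow_uniform[OF uC'] by (simp add: pC' qC')
    moreover have "q + card (verts C) \<le> p + card (shadow 2 C)"
    proof -
      \<comment> \<open>For \<open>e = 3\<close> the rounded-up half of \<open>e\<close> is 2, so
        the difference hypothesis reaches index 2.\<close>
      have "first_difference h' ! 2 \<le> first_difference h ! 2"
        using assms(7) 3 len by (auto simp: le_ceiling_iff)
      then show ?thesis
        using 3 len h1 h2 by (simp add: first_difference_def nth_Cons' p_def q_def numeral_2_eq_2)
    qed
    moreover have "1 \<le> p" using verts1 3 by (simp add: pC')
    moreover have "p \<le> card (verts C)" using spec[OF assms(8), of 1] 3 h1 by (simp add: p_def)
    ultimately obtain D where D: "uniform 3 D" "card (verts D) = card (verts C) + 1"
      "card (shadow 2 D) = card (shadow 2 C) + p" "card D = card C + q"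
      using shifted_sum_degree_3[of C p q] C(1) 3 by auto
    show ?thesis
    proof (rule pure_shifted_sum)
      show "uniform e D" using D(1) 3 by simp
      show "D \<noteq> {}" using D(2) by (auto simp: verts_def)
      fix i assume "0 < i" "i \<le> e"
      then consider "i = 1" | "i = 2" | "i = 3" using 3 by linarith
      then show "h ! i + h' ! (i - 1) = card (shadow i D)"
        by cases (use D h1 h2 he h'0 3 card_shadow_1[of D] shadow_uniform[OF D(1)]
            in \<open>simp_all add: p_def q_def\<close>)
    qed (use len in auto)
  qed
qed

end
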